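(* Let $K$ be an irreducible Markov kernel on a finite state space $\mathcal{X}$ with $|\mathcal X|\ge2$, with invariant probability measure $\pi$. The spectral profile $\Lambda(r)$ and the log-Sobolev constant $\rho$ satisfy, for all $r\ge\pi_*$ with $r\neq1$, $$\Lambda(r) \geq \rho\,\frac{\log(1/r)}{1-r}.$$
   Context: $\pi_*=\min_x\pi(x)>0$. Dirichlet form: $\mathcal{E}(f,g)=\langle (I-K)f,g\rangle_\pi=\sum_x((I-K)f)(x)g(x)\pi(x)$; $\mathrm{Var}$ is the variance with respect to $\pi$. The log-Sobolev constant is $$\rho = \inf_{f:\ \mathrm{Ent}_{\pi} (f^2)\neq 0} \frac{\mathcal E(f,f)}{\mathrm{Ent}_{\pi}( f^2)},\qquad \mathrm{Ent}_{\pi}(f^2) = \sum_{x \in \mathcal{X}}f^2(x)\log\left(f^2(x)/\|f\|_2^2\right)\pi(x),$$ with $\|\cdot\|_2$ the $L^2(\pi)$ norm. The spectral profile is $$\Lambda(r)=\inf_{\pi_*\le\pi(S)\le r}\ \inf_{f\in c_0^+(S)}\frac{\mathcal E(f,f)}{\mathrm{Var}(f)},\qquad r\ge\pi_*,$$ where $c_0^+(S)=\{f:\mathcal X\to\mathbb R:\ \mathrm{supp}(f)\subset S,\ f\ge0,\ f\ne\text{constant}\}$. *)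

theory Defs
  imports "HOL-Probability.Probability"
begin

text \<open>
  The state space is a type of class \<open>finite\<close>. A Markov kernel on it is a function
  \<open>K :: 'a \<Rightarrow> 'a pmf\<close>, with \<open>K(x,y) = pmf (K x) y\<close>.
\<close>

primrec kernel_power :: "('a \<Rightarrow> 'a pmf) \<Rightarrow> nat \<Rightarrow> 'a \<Rightarrow> 'a pmf" where
  "kernel_power K 0 x = return_pmf x"
| "kernel_power K (Suc n) x = bind_pmf (K x) (kernel_power K n)"

definition irreducible_kernel :: "('a \<Rightarrow> 'a pmf) \<Rightarrow> bool" where
  "irreducible_kernel K \<longleftrightarrow> (\<forall>x y. \<exists>n. pmf (kernel_power K n x) y > 0)"

definition invariant_pmf :: "('a \<Rightarrow> 'a pmf) \<Rightarrow> 'a pmf \<Rightarrow> bool" where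
  "invariant_pmf K \<pi> \<longleftrightarrow> bind_pmf \<pi> K = \<pi>"

definition min_prob :: "'a::finite pmf \<Rightarrow> real" where
  "min_prob \<pi> = (MIN x. pmf \<pi> x)"

definition kernel_op :: "('a::finite \<Rightarrow> 'a pmf) \<Rightarrow> ('a \<Rightarrow> real) \<Rightarrow> 'a \<Rightarrow> real" where
  "kernel_op K f x = (\<Sum>y\<in>UNIV. pmf (K x) y * f y)"

definition dirichlet_form ::
    "('a::finite \<Rightarrow> 'a pmf) \<Rightarrow> 'a pmf \<Rightarrow> ('a \<Rightarrow> real) \<Rightarrow> ('a \<Rightarrow> real) \<Rightarrow> real" where
  "dirichlet_form K \<pi> f g = (\<Sum>x\<in>UNIV. (f x - kernel_op K f x) * g x * pmf \<pi> x)"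

definition L2_norm :: "'a::finite pmf \<Rightarrow> ('a \<Rightarrow> real) \<Rightarrow> real" where
  "L2_norm \<pi> f = sqrt (\<Sum>x\<in>UNIV. (f x)\<^sup>2 * pmf \<pi> x)"

text \<open>
  \<open>Ent\<^sub>\<pi>(f\<^sup>2)\<close> as a function of \<open>f\<close>. Where \<open>f x = 0\<close> the summand is \<open>0\<close>,
  which is the usual convention \<open>0 log 0 = 0\<close>.
\<close>

definition ent_sq :: "'a::finite pmf \<Rightarrow> ('a \<Rightarrow> real) \<Rightarrow> real" where
  "ent_sq \<pi> f = (\<Sum>x\<in>UNIV. (f x)\<^sup>2 * ln ((f x)\<^sup>2 / (L2_norm \<pi> f)\<^sup>2) * pmf \<pi> x)"

text \<open>
  The infima below are infima of reals. For an invariant \<open>\<pi>\<close> the quotients are nonnegative,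
  and for an irreducible kernel on at least two states the index sets are nonempty, in the case
  of the spectral profile provided that \<open>min_prob \<pi> \<le> r\<close> (for smaller \<open>r\<close> its value carries
  no meaning).
\<close>

definition log_sobolev_const :: "('a::finite \<Rightarrow> 'a pmf) \<Rightarrow> 'a pmf \<Rightarrow> real" where
  "log_sobolev_const K \<pi> =
     (INF f\<in>{f. ent_sq \<pi> f \<noteq> 0}. dirichlet_form K \<pi> f f / ent_sq \<pi> f)"

definition c0_plus :: "'a set \<Rightarrow> ('a \<Rightarrow> real) set" where
  "c0_plus S = {f. {x. f x \<noteq> 0} \<subseteq> S \<and> (\<forall>x. f x \<ge> 0) \<and> \<not> f constant_on UNIV}"

definition spectral_profile :: "('a::finite \<Rightarrow> 'a pmf) \<Rightarrow> 'a pmf \<Rightarrow> real \<Rightarrow> real" where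
  "spectral_profile K \<pi> r =
     (INF S\<in>{S. min_prob \<pi> \<le> measure_pmf.prob \<pi> S \<and> measure_pmf.prob \<pi> S \<le> r}.
        INF f\<in>c0_plus S. dirichlet_form K \<pi> f f / measure_pmf.variance \<pi> f)"

end

theory Submission imports Defs begin

text \<open>
  The theorem reduces to a functional inequality that does not involve the kernel. Let
  \<open>f \<ge> 0\<close> be nonconstant with support in \<open>S\<close>, \<open>\<pi>(S) \<le> r\<close>, and write \<open>m\<close> for the mean of \<open>f\<close>,
  \<open>A\<close> for the mean of \<open>f\<^sup>2\<close>, and \<open>t = m\<^sup>2 / A\<close>. Then \<open>Var(f) = A (1 - t)\<close>. Jensen's inequality
  for the probability measure \<open>f\<^sup>2 \<pi> / A\<close> and the concave function \<open>ln\<close> gives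
  \<open>Ent(f\<^sup>2) \<ge> A ln (1 / t)\<close> (\<open>ent_sq_ge_mean_ratio\<close>), so that
  \<open>Ent(f\<^sup>2) / Var(f) \<ge> ln (1 / t) / (1 - t)\<close>. The Cauchy--Schwarz inequality on \<open>S\<close>
  gives \<open>t \<le> \<pi>(S) \<le> r\<close> (\<open>expectation_square_le_support\<close>), and
  \<open>ln (1 / t) / (1 - t)\<close> decreases in \<open>t\<close> (\<open>log_slope_antimono\<close>). Hence
  \<open>Ent(f\<^sup>2) \<ge> Var(f) ln (1 / r) / (1 - r)\<close>.

  The kernel enters only through \<open>\<E>(f,f) \<ge> \<rho> Ent(f\<^sup>2)\<close>. To chain the two inequalities one needs
  \<open>\<rho> \<ge> 0\<close>, which holds because the Dirichlet form of an invariant measure is half of a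
  sum of squares and entropies are nonnegative.
\<close>

section \<open>Invariant measures and the Dirichlet form\<close>

lemma expectation_eq_sum:
  fixes \<pi> :: "'a::finite pmf" and f :: "'a \<Rightarrow> real"
  shows "measure_pmf.expectation \<pi> f = (\<Sum>x\<in>UNIV. f x * pmf \<pi> x)"
  by (subst integral_measure_pmf_real[where A = UNIV]) auto

lemma bind_kernel_power_invariant:
  assumes "invariant_pmf K \<pi>"
  shows "bind_pmf \<pi> (kernel_power K n) = \<pi>"
proof (induction n)
  case 0
  then show ?case by (simp add: bind_return_pmf')
next
  case (Suc n)
  have "bind_pmf \<pi> (kernel_power K (Suc n)) = bind_pmf (bind_pmf \<pi> K) (kernel_power K n)"
    by (simp add: bind_assoc_pmf fun_eq_iff cong: bind_pmf_cong)
  also have "\<dots> = \<pi>"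
    using assms Suc by (simp add: invariant_pmf_def)
  finally show ?case .
qed

text \<open>
  Irreducibility moves part of the mass of any one charged state to \<open>y\<close> in finitely many
  steps, and invariance says that the measure after those steps is still \<open>\<pi>\<close>.
\<close>

lemma pmf_invariant_pos:
  assumes "irreducible_kernel K" and "invariant_pmf K \<pi>"
  shows "pmf \<pi> y > 0"
proof -
  obtain x where x: "x \<in> set_pmf \<pi>"
    using set_pmf_not_empty[of \<pi>] by blast
  obtain n where "pmf (kernel_power K n x) y > 0"
    using assms(1) by (auto simp: irreducible_kernel_def)
  then have "y \<in> set_pmf (bind_pmf \<pi> (kernel_power K n))"
    using x by (force simp: set_pmf_iff[of y])
  then show ?thesis
    using bind_kernel_power_invariant[OF assms(2)] by (simp add: pmf_positive)
qed

lemma sum_kernel_invariant: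
  fixes \<pi> :: "'a::finite pmf"
  assumes "invariant_pmf K \<pi>"
  shows "(\<Sum>x\<in>UNIV. pmf (K x) y * pmf \<pi> x) = pmf \<pi> y"
proof -
  have "pmf (bind_pmf \<pi> K) y = (\<Sum>x\<in>UNIV. pmf (K x) y * pmf \<pi> x)"
    by (simp add: pmf_bind expectation_eq_sum)
  then show ?thesis
    using assms by (simp add: invariant_pmf_def)
qed

text \<open>
  Expand the square: the rows of \<open>K\<close> sum to one and, by invariance, the second marginal of
  \<open>\<pi>(x) K(x,y)\<close> is \<open>\<pi>\<close>, so both square terms contribute the mean of \<open>f\<^sup>2\<close>.
\<close>

lemma dirichlet_form_eq_sum_squares:
  fixes \<pi> :: "'a::finite pmf"
  assumes "invariant_pmf K \<pi>"
  shows "2 * dirichlet_form K \<pi> f f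
    = (\<Sum>x\<in>UNIV. \<Sum>y\<in>UNIV. (f x - f y)\<^sup>2 * pmf (K x) y * pmf \<pi> x)"
proof -
  have row: "(\<Sum>y\<in>UNIV. pmf (K x) y) = 1" for x
    by (rule sum_pmf_eq_1) auto
  have fst_marg: "(\<Sum>x\<in>UNIV. \<Sum>y\<in>UNIV. (f x)\<^sup>2 * pmf (K x) y * pmf \<pi> x)
      = (\<Sum>x\<in>UNIV. (f x)\<^sup>2 * pmf \<pi> x)"
    by (simp add: row flip: sum_distrib_left sum_distrib_right)
  have "(\<Sum>x\<in>UNIV. \<Sum>y\<in>UNIV. (f y)\<^sup>2 * pmf (K x) y * pmf \<pi> x)
      = (\<Sum>y\<in>UNIV. (f y)\<^sup>2 * (\<Sum>x\<in>UNIV. pmf (K x) y * pmf \<pi> x))"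
    by (subst sum.swap) (simp add: sum_distrib_left mult.assoc)
  also have "\<dots> = (\<Sum>y\<in>UNIV. (f y)\<^sup>2 * pmf \<pi> y)"
    by (simp add: sum_kernel_invariant[OF assms])
  finally have snd_marg: "(\<Sum>x\<in>UNIV. \<Sum>y\<in>UNIV. (f y)\<^sup>2 * pmf (K x) y * pmf \<pi> x)
      = (\<Sum>y\<in>UNIV. (f y)\<^sup>2 * pmf \<pi> y)" .
  have "(\<Sum>x\<in>UNIV. \<Sum>y\<in>UNIV. (f x - f y)\<^sup>2 * pmf (K x) y * pmf \<pi> x)
      = (\<Sum>x\<in>UNIV. \<Sum>y\<in>UNIV. (f x)\<^sup>2 * pmf (K x) y * pmf \<pi> x
          + (f y)\<^sup>2 * pmf (K x) y * pmf \<pi> x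
          - 2 * (pmf (K x) y * f y * f x * pmf \<pi> x))"
    by (intro sum.cong refl) (simp add: power2_eq_square algebra_simps)
  also have "\<dots> = 2 * (\<Sum>x\<in>UNIV. (f x)\<^sup>2 * pmf \<pi> x)
      - 2 * (\<Sum>x\<in>UNIV. \<Sum>y\<in>UNIV. pmf (K x) y * f y * f x * pmf \<pi> x)"
    using fst_marg snd_marg
    by (simp add: sum.distrib sum_subtractf flip: sum_distrib_left)
  also have "\<dots> = 2 * dirichlet_form K \<pi> f f"
    by (simp add: dirichlet_form_def kernel_op_def left_diff_distrib sum_subtractf
        sum_distrib_right power2_eq_square)
  finally show ?thesis by simp
qed

lemma dirichlet_form_nonneg:
  fixes \<pi> :: "'a::finite pmf"
  assumes "invariant_pmf K \<pi>"
  shows "dirichlet_form K \<pi> f f \<ge> 0"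
proof -
  have "2 * dirichlet_form K \<pi> f f \<ge> 0"
    unfolding dirichlet_form_eq_sum_squares[OF assms] by (intro sum_nonneg) auto
  then show ?thesis by simp
qed

section \<open>Entropy, variance and support\<close>

lemma variance_eq_moments:
  fixes \<pi> :: "'a::finite pmf" and f :: "'a \<Rightarrow> real"
  shows "measure_pmf.variance \<pi> f
    = measure_pmf.expectation \<pi> (\<lambda>x. (f x)\<^sup>2) - (measure_pmf.expectation \<pi> f)\<^sup>2"
  by (rule measure_pmf.variance_eq) (auto intro: integrable_measure_pmf_finite)

lemma variance_pos:
  fixes \<pi> :: "'a::finite pmf" and f :: "'a \<Rightarrow> real"
  assumes "\<And>x. pmf \<pi> x > 0" and "\<not> f constant_on UNIV"
  shows "measure_pmf.variance \<pi> f > 0"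
proof -
  obtain x where "f x \<noteq> measure_pmf.expectation \<pi> f"
    using assms(2) by (auto simp: constant_on_def)
  then show ?thesis
    unfolding expectation_eq_sum[of \<pi> "\<lambda>x. (f x - measure_pmf.expectation \<pi> f)\<^sup>2"]
    using assms(1) by (intro sum_pos2[of _ x]) (auto intro: less_imp_le)
qed

lemma expectation_square_le_support:
  fixes \<pi> :: "'a::finite pmf" and f :: "'a \<Rightarrow> real"
  assumes "{x. f x \<noteq> 0} \<subseteq> S"
  shows "(measure_pmf.expectation \<pi> f)\<^sup>2
    \<le> measure_pmf.prob \<pi> S * measure_pmf.expectation \<pi> (\<lambda>x. (f x)\<^sup>2)"
proof -
  have *: "(\<Sum>x\<in>UNIV. g x) = (\<Sum>x\<in>S. g x)" if "\<And>x. f x = 0 \<Longrightarrow> g x = 0" for g :: "'a \<Rightarrow> real"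
    using that assms by (intro sum.mono_neutral_right) auto
  have "(\<Sum>x\<in>S. f x * pmf \<pi> x)\<^sup>2
      = (\<Sum>x\<in>S. sqrt (pmf \<pi> x) * (f x * sqrt (pmf \<pi> x)))\<^sup>2"
    by (simp add: mult.left_commute)
  also have "\<dots> \<le> (\<Sum>x\<in>S. (sqrt (pmf \<pi> x))\<^sup>2) * (\<Sum>x\<in>S. (f x * sqrt (pmf \<pi> x))\<^sup>2)"
    by (rule Cauchy_Schwarz_ineq_sum)
  finally show ?thesis
    by (simp add: expectation_eq_sum * measure_measure_pmf_finite power_mult_distrib)
qed

lemma L2_norm_square:
  "(L2_norm \<pi> f)\<^sup>2 = measure_pmf.expectation \<pi> (\<lambda>x. (f x)\<^sup>2)"
  by (simp add: L2_norm_def expectation_eq_sum sum_nonneg)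

text \<open>
  Jensen's inequality for \<open>ln\<close> under the probability measure \<open>f\<^sup>2 \<pi> / A\<close>, where \<open>A\<close> is the mean
  of \<open>f\<^sup>2\<close>: the mean of \<open>1 / f\<close> under it is \<open>m / A\<close>. The proof uses the tangent line of \<open>ln\<close>
  at \<open>1\<close>.
\<close>

lemma ent_sq_ge_mean_ratio:
  fixes \<pi> :: "'a::finite pmf" and f :: "'a \<Rightarrow> real"
  defines "m \<equiv> measure_pmf.expectation \<pi> f"
    and "A \<equiv> measure_pmf.expectation \<pi> (\<lambda>x. (f x)\<^sup>2)"
  assumes nonneg: "\<And>x. f x \<ge> 0" and m: "m > 0" and A: "A > 0"
  shows "ent_sq \<pi> f \<ge> A * ln (A / m\<^sup>2)"
proof -
  have term_bound: "(f x)\<^sup>2 * ln ((f x)\<^sup>2 / A)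
      \<ge> (f x)\<^sup>2 * ln (A / m\<^sup>2) + 2 * (f x)\<^sup>2 - 2 * (A / m) * f x" for x
  proof (cases "f x = 0")
    case False
    then have fx: "f x > 0" using nonneg[of x] by simp
    have "ln ((f x)\<^sup>2 / A) = ln (A / m\<^sup>2) - 2 * ln (A / (m * f x))"
      using fx m A by (simp add: ln_div ln_mult ln_realpow)
    moreover have "ln (A / (m * f x)) \<le> A / (m * f x) - 1"
      using fx m A by (intro ln_le_minus_one) simp
    ultimately have "ln ((f x)\<^sup>2 / A) \<ge> ln (A / m\<^sup>2) + 2 - 2 * (A / (m * f x))"
      by simp
    then have "(f x)\<^sup>2 * ln ((f x)\<^sup>2 / A)
        \<ge> (f x)\<^sup>2 * (ln (A / m\<^sup>2) + 2 - 2 * (A / (m * f x)))"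
      by (intro mult_left_mono) auto
    also have "(f x)\<^sup>2 * (ln (A / m\<^sup>2) + 2 - 2 * (A / (m * f x)))
        = (f x)\<^sup>2 * ln (A / m\<^sup>2) + 2 * (f x)\<^sup>2 - 2 * (A / m) * f x"
      using fx m by (simp add: field_simps power2_eq_square)
    finally show ?thesis .
  qed simp
  have linear: "(\<Sum>x\<in>UNIV. ((f x)\<^sup>2 * c + 2 * (f x)\<^sup>2 - d * f x) * pmf \<pi> x)
      = c * A + 2 * A - d * m" for c d
    unfolding A_def m_def expectation_eq_sum
    by (simp add: sum.distrib sum_subtractf sum_distrib_left algebra_simps)
  have "ent_sq \<pi> f = (\<Sum>x\<in>UNIV. (f x)\<^sup>2 * ln ((f x)\<^sup>2 / A) * pmf \<pi> x)"
    by (simp add: ent_sq_def L2_norm_square A_def)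
  also have "\<dots> \<ge> (\<Sum>x\<in>UNIV. ((f x)\<^sup>2 * ln (A / m\<^sup>2) + 2 * (f x)\<^sup>2 - 2 * (A / m) * f x) * pmf \<pi> x)"
    by (intro sum_mono mult_right_mono term_bound) auto
  also have "(\<Sum>x\<in>UNIV. ((f x)\<^sup>2 * ln (A / m\<^sup>2) + 2 * (f x)\<^sup>2 - 2 * (A / m) * f x) * pmf \<pi> x)
      = ln (A / m\<^sup>2) * A + 2 * A - 2 * (A / m) * m"
    by (rule linear)
  also have "\<dots> = A * ln (A / m\<^sup>2)"
    using m by simp
  finally show ?thesis .
qed

lemma ent_sq_abs: "ent_sq \<pi> (\<lambda>x. \<bar>f x\<bar>) = ent_sq \<pi> f"
  by (simp add: ent_sq_def L2_norm_def)

lemma ent_sq_nonneg: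
  fixes \<pi> :: "'a::finite pmf"
  assumes pos: "\<And>x. pmf \<pi> x > 0"
  shows "ent_sq \<pi> f \<ge> 0"
proof (cases "\<forall>x. f x = 0")
  case True
  then show ?thesis by (simp add: ent_sq_def)
next
  case False
  then obtain x where x: "f x \<noteq> 0" by blast
  let ?g = "\<lambda>x. \<bar>f x\<bar>"
  let ?m = "measure_pmf.expectation \<pi> ?g"
  let ?A = "measure_pmf.expectation \<pi> (\<lambda>x. (?g x)\<^sup>2)"
  have m: "?m > 0"
    unfolding expectation_eq_sum using x pos
    by (intro sum_pos2[of _ x]) (auto intro: less_imp_le)
  have "?m\<^sup>2 \<le> ?A"
    using expectation_square_le_support[of ?g UNIV \<pi>] by simp
  moreover from this m have "?A > 0"
    by (meson less_le_trans zero_less_power)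
  ultimately have "?A * ln (?A / ?m\<^sup>2) \<ge> 0"
    using m by (intro mult_nonneg_nonneg ln_ge_zero) (simp_all add: field_simps)
  also have "\<dots> \<le> ent_sq \<pi> ?g"
    using m \<open>?A > 0\<close> by (intro ent_sq_ge_mean_ratio) auto
  finally show ?thesis by (simp add: ent_sq_abs)
qed

text \<open>
  The slope of \<open>ln\<close> between \<open>1\<close> and \<open>t\<close> decreases in \<open>t\<close>, by concavity. The denominator
  \<open>1 - t\<close> is cleared so that the bound is in the form used below.
\<close>

lemma log_slope_antimono:
  fixes t r :: real
  assumes "0 < t" "t < 1" "t \<le> r" "r \<noteq> 1"
  shows "(1 - t) * (ln (1 / r) / (1 - r)) \<le> ln (1 / t)"
proof (cases "r < 1")
  case True
  \<comment> \<open>\<open>r\<close> is the convex combination of \<open>t\<close> and \<open>1\<close> with weight \<open>(1 - r) / (1 - t)\<close> on \<open>t\<close>.\<close>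
  define c where "c = (1 - r) / (1 - t)"
  have c: "0 \<le> c" "c \<le> 1"
    using True assms by (auto simp: c_def field_simps)
  have comb: "(1 - c) * 1 + c * t = r"
  proof -
    have "c * (1 - t) = 1 - r"
      using assms by (simp add: c_def)
    then show ?thesis by (simp add: algebra_simps)
  qed
  have "concave_on {0<..} (ln :: real \<Rightarrow> real)"
    by (rule ln_concave)
  from concave_onD[OF this, of c 1 t] have "c * ln t \<le> ln r"
    using c comb assms by simp
  then have "(1 - r) * ln t \<le> (1 - t) * ln r"
    using assms by (simp add: c_def field_simps)
  then show ?thesis
    using True assms by (simp add: ln_div field_simps)
next
  case False
  \<comment> \<open>Here the two slopes are separated by the slope of the tangent at \<open>1\<close>, which is \<open>1\<close>.\<close>
  then have r: "r > 1" using assms by simp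
  have "ln (1 / r) / (1 - r) \<le> 1"
    using r ln_le_minus_one[of r] by (simp add: ln_div field_simps)
  then have "(1 - t) * (ln (1 / r) / (1 - r)) \<le> 1 - t"
    using assms mult_left_mono[of "ln (1 / r) / (1 - r)" 1 "1 - t"] by simp
  also have "\<dots> \<le> ln (1 / t)"
    using assms ln_le_minus_one[of t] by (simp add: ln_div)
  finally show ?thesis .
qed

lemma ent_sq_ge_variance:
  fixes \<pi> :: "'a::finite pmf"
  assumes pos: "\<And>x. pmf \<pi> x > 0" and f: "f \<in> c0_plus S"
    and S: "measure_pmf.prob \<pi> S \<le> r" and r: "r \<noteq> 1"
  shows "ent_sq \<pi> f \<ge> measure_pmf.variance \<pi> f * (ln (1 / r) / (1 - r))"
proof -
  let ?m = "measure_pmf.expectation \<pi> f"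
  let ?A = "measure_pmf.expectation \<pi> (\<lambda>x. (f x)\<^sup>2)"
  from f have supp: "{x. f x \<noteq> 0} \<subseteq> S" and nonneg: "\<And>x. f x \<ge> 0"
    and nc: "\<not> f constant_on UNIV"
    by (auto simp: c0_plus_def)
  obtain x where x: "f x \<noteq> 0" using nc by (auto simp: constant_on_def)
  have m: "?m > 0"
    unfolding expectation_eq_sum using x pos nonneg
    by (intro sum_pos2[of _ x]) (auto intro: less_imp_le simp: less_le)
  have mA: "?m\<^sup>2 < ?A"
    using variance_pos[OF pos nc] unfolding variance_eq_moments by simp
  with m have A: "?A > 0"
    by (meson less_trans zero_less_power)
  define t where "t = ?m\<^sup>2 / ?A"
  have t: "0 < t" "t < 1"
    using m mA A by (auto simp: t_def)
  have "t \<le> measure_pmf.prob \<pi> S"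
    using expectation_square_le_support[OF supp, of \<pi>] A by (simp add: t_def field_simps)
  with S have "t \<le> r" by simp
  have "measure_pmf.variance \<pi> f = ?A * (1 - t)"
    unfolding variance_eq_moments using A by (simp add: t_def field_simps)
  then have "measure_pmf.variance \<pi> f * (ln (1 / r) / (1 - r))
      = ?A * ((1 - t) * (ln (1 / r) / (1 - r)))"
    by (simp only: mult.assoc)
  also have "\<dots> \<le> ?A * ln (1 / t)"
    using A log_slope_antimono[OF t \<open>t \<le> r\<close> r] by (intro mult_left_mono) auto
  also have "\<dots> \<le> ent_sq \<pi> f"
    using ent_sq_ge_mean_ratio[OF nonneg m A] by (simp add: t_def)
  finally show ?thesis .
qed

lemma ent_sq_pos:
  fixes \<pi> :: "'a::finite pmf"
  assumes pos: "\<And>x. pmf \<pi> x > 0" and f: "f \<in> c0_plus S"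
  shows "ent_sq \<pi> f > 0"
proof -
  \<comment> \<open>The constant \<open>ln (1 / r) / (1 - r)\<close> is positive for each \<open>r > 1\<close>; take \<open>r = 2\<close>.\<close>
  have "measure_pmf.prob \<pi> S \<le> 2"
    by (rule order_trans[OF measure_pmf.prob_le_1]) simp
  from ent_sq_ge_variance[OF pos f this]
  have "measure_pmf.variance \<pi> f * ln 2 \<le> ent_sq \<pi> f"
    by (simp add: ln_div)
  moreover have "measure_pmf.variance \<pi> f > 0"
    using f by (intro variance_pos pos) (simp add: c0_plus_def)
  then have "measure_pmf.variance \<pi> f * ln 2 > 0" by (intro mult_pos_pos) auto
  ultimately show ?thesis by linarith
qed

section \<open>The spectral profile\<close>

text \<open>
  Nonnegativity of all the quotients is what makes \<open>\<rho>\<close> the infimum of a set that is bounded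
  below, so that it is a lower bound of each of them.
\<close>

lemma log_sobolev_quotient_nonneg:
  fixes \<pi> :: "'a::finite pmf"
  assumes "\<And>x. pmf \<pi> x > 0" and "invariant_pmf K \<pi>"
  shows "dirichlet_form K \<pi> f f / ent_sq \<pi> f \<ge> 0"
  by (intro divide_nonneg_nonneg dirichlet_form_nonneg ent_sq_nonneg assms)

lemma log_sobolev_ineq:
  fixes \<pi> :: "'a::finite pmf"
  assumes pos: "\<And>x. pmf \<pi> x > 0" and inv: "invariant_pmf K \<pi>" and ent: "ent_sq \<pi> f \<noteq> 0"
  shows "log_sobolev_const K \<pi> * ent_sq \<pi> f \<le> dirichlet_form K \<pi> f f"
proof -
  have "log_sobolev_const K \<pi> \<le> dirichlet_form K \<pi> f f / ent_sq \<pi> f"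
    unfolding log_sobolev_const_def
    using ent log_sobolev_quotient_nonneg[OF pos inv]
    by (intro cINF_lower bdd_belowI2[where m = 0]) auto
  moreover have "ent_sq \<pi> f > 0"
    using ent ent_sq_nonneg[of \<pi> f] pos by (simp add: less_le)
  ultimately show ?thesis by (simp add: field_simps)
qed

lemma log_sobolev_const_nonneg:
  fixes \<pi> :: "'a::finite pmf"
  assumes pos: "\<And>x. pmf \<pi> x > 0" and inv: "invariant_pmf K \<pi>" and ent: "ent_sq \<pi> f \<noteq> 0"
  shows "log_sobolev_const K \<pi> \<ge> 0"
  unfolding log_sobolev_const_def
  using ent log_sobolev_quotient_nonneg[OF pos inv] by (intro cINF_greatest) auto

lemma indicator_in_c0_plus:
  assumes "CARD('a::finite) \<ge> 2" and "x \<in> S"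
  shows "(indicator {x} :: 'a \<Rightarrow> real) \<in> c0_plus S"
proof -
  obtain y :: 'a where y: "y \<noteq> x"
  proof (rule ccontr)
    assume "\<not> thesis"
    with that have "\<nexists>y. y \<noteq> x" by blast
    then have "(UNIV :: 'a set) = {x}" by auto
    then have "CARD('a) = card {x}" by (rule arg_cong)
    with assms(1) show False by simp
  qed
  have "\<not> (indicator {x} :: 'a \<Rightarrow> real) constant_on UNIV"
  proof
    assume "(indicator {x} :: 'a \<Rightarrow> real) constant_on UNIV"
    then obtain c :: real where "\<And>z. indicator {x} z = c"
      by (auto simp: constant_on_def)
    from this[of x] this[of y] y show False by simp
  qed
  then show ?thesis
    using assms(2) by (auto simp: c0_plus_def indicator_def split: if_splits)
qed

theorem lemma4p2:
  fixes K :: "'a::finite \<Rightarrow> 'a pmf" and \<pi> :: "'a pmf" and r :: real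
  assumes "CARD('a) \<ge> 2"
    and "irreducible_kernel K"
    and "invariant_pmf K \<pi>"
    and "r \<ge> min_prob \<pi>"
    and "r \<noteq> 1"
  shows "spectral_profile K \<pi> r \<ge> log_sobolev_const K \<pi> * (ln (1 / r) / (1 - r))"
proof -
  let ?\<rho> = "log_sobolev_const K \<pi>" and ?c = "ln (1 / r) / (1 - r)"
  have pos: "pmf \<pi> x > 0" for x
    by (rule pmf_invariant_pos[OF assms(2,3)])
  have "min_prob \<pi> \<in> range (pmf \<pi>)"
    unfolding min_prob_def by (rule Min_in) auto
  then obtain x\<^sub>0 where x0: "min_prob \<pi> = pmf \<pi> x\<^sub>0" by blast
  have quotient: "?\<rho> * ?c \<le> dirichlet_form K \<pi> f f / measure_pmf.variance \<pi> f"
    if S: "measure_pmf.prob \<pi> S \<le> r" and f: "f \<in> c0_plus S" for S f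
  proof -
    have ent: "ent_sq \<pi> f \<noteq> 0"
      using ent_sq_pos[OF pos f] by simp
    have var: "measure_pmf.variance \<pi> f > 0"
      using f by (intro variance_pos pos) (simp add: c0_plus_def)
    have "?\<rho> * (measure_pmf.variance \<pi> f * ?c) \<le> ?\<rho> * ent_sq \<pi> f"
      by (intro mult_left_mono ent_sq_ge_variance[OF pos f S assms(5)]
          log_sobolev_const_nonneg[OF pos assms(3) ent])
    also have "\<dots> \<le> dirichlet_form K \<pi> f f"
      by (rule log_sobolev_ineq[OF pos assms(3) ent])
    finally have "?\<rho> * ?c * measure_pmf.variance \<pi> f \<le> dirichlet_form K \<pi> f f"
      by (simp only: mult_ac)
    then show ?thesis
      by (simp only: pos_le_divide_eq[OF var])
  qed
  show ?thesis
    unfolding spectral_profile_def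
  proof (intro cINF_greatest)
    \<comment> \<open>A state of least mass is an admissible set.\<close>
    have "{x\<^sub>0} \<in> {S. min_prob \<pi> \<le> measure_pmf.prob \<pi> S \<and> measure_pmf.prob \<pi> S \<le> r}"
      using x0 assms(4) by (simp add: measure_pmf_single)
    then show "{S. min_prob \<pi> \<le> measure_pmf.prob \<pi> S \<and> measure_pmf.prob \<pi> S \<le> r} \<noteq> {}"
      by blast
  next
    fix S
    assume "S \<in> {S. min_prob \<pi> \<le> measure_pmf.prob \<pi> S \<and> measure_pmf.prob \<pi> S \<le> r}"
    then have "measure_pmf.prob \<pi> S > 0"
      using x0 pos[of x\<^sub>0] by simp
    then obtain x where "x \<in> S" by fastforce
    then show "c0_plus S \<noteq> {}"
      using indicator_in_c0_plus[OF assms(1)] by blast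
  qed (use quotient in auto)
qed

end
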